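(* Let $\alpha>0$. For $\beta\in\mathbb{R}$ let $\mathcal{F}_{\beta,\alpha}$ be the set of positive twice differentiable functions $f$ on $(0,\infty)$ such that $(\log f)''\ge-\beta$ and $\int f\,d\nu_\alpha=1$. Then, for all $\beta>0$, $$\limsup_{t\to\infty}\ t\sup_{f\in\mathcal{F}_{\beta,\alpha}}\nu_\alpha(\{x:f(x)\ge t\})>0.$$
   Context: $\nu_\alpha$ is the Gamma probability distribution on $(0,\infty)$ with density $\varphi_\alpha(x)=\frac{1}{\Gamma(\alpha)}x^{\alpha-1}e^{-x}$, $x>0$, with respect to Lebesgue measure. *)

theory Defs
  imports "HOL-Analysis.Analysis"
begin

definition gamma_density :: "real \<Rightarrow> real \<Rightarrow> real" where
  "gamma_density \<alpha> x = 1 / Gamma \<alpha> * x powr (\<alpha> - 1) * exp (- x)"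

text \<open>The underlying space is \<open>{0<..}\<close> itself rather than the whole line, so that measurability
  and integrability with respect to this measure ignore the values of a function outside
  \<open>(0, \<infinity>)\<close>.\<close>

definition gamma_measure :: "real \<Rightarrow> real measure" where
  "gamma_measure \<alpha> =
     density (restrict_space lborel {0<..}) (\<lambda>x. ennreal (gamma_density \<alpha> x))"

text \<open>A function on \<open>(0, \<infinity>)\<close> is a total function of type \<open>real \<Rightarrow> real\<close> that is constrained only
  on \<open>{0<..}\<close>. As that set is open, the derivatives at its points do not depend on the values
  elsewhere. The second derivative need not be continuous.\<close>

definition semi_log_convex_densities :: "real \<Rightarrow> real \<Rightarrow> (real \<Rightarrow> real) set" where
  "semi_log_convex_densities \<beta> \<alpha> =
     {f. (\<forall>x>0. f x > 0) \<and>
         (\<forall>x>0. f differentiable (at x)) \<and>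
         (\<forall>x>0. deriv f differentiable (at x)) \<and>
         (\<forall>x>0. deriv (deriv (\<lambda>y. ln (f y))) x \<ge> - \<beta>) \<and>
         integrable (gamma_measure \<alpha>) f \<and>
         integral\<^sup>L (gamma_measure \<alpha>) f = 1}"

end

theory Submission
  imports Defs "HOL-Real_Asymp.Real_Asymp"
begin

text \<open>
  For \<open>a \<ge> 1\<close> take the density \<open>f x = exp (x - \<beta> / 2 * (x - a)\<^sup>2) / Z\<close>, where \<open>Z\<close> normalises the integral
  to 1. Its logarithm has second derivative exactly \<open>-\<beta>\<close>, and the factor \<open>exp x\<close> cancels the
  exponential decay of the Gamma density: \<open>Z * Gamma \<alpha>\<close> is the integral over \<open>(0, \<infinity>)\<close> of
  \<open>x powr (\<alpha> - 1)\<close> against a Gaussian bump of fixed width centred at \<open>a\<close>. Hence \<open>Z\<close> is at most a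
  constant multiple of \<open>a powr (\<alpha> - 1)\<close>, uniformly in \<open>a\<close> (\<open>gaussian_weight_bound\<close>).

  Let \<open>t = exp a / Z\<close>, which tends to infinity with \<open>a\<close>. The set where \<open>f \<ge> t\<close> is exactly the set where
  \<open>\<beta> / 2 * (x - a)\<^sup>2 \<le> x - a\<close>, the interval \<open>[a, a + 2 / \<beta>]\<close>. Its Gamma measure is at least a constant
  multiple of \<open>a powr (\<alpha> - 1) * exp (- a)\<close> (\<open>emeasure_gamma_measure_Icc_ge\<close>), so \<open>t\<close> times this measure
  is bounded below by a positive constant that does not depend on \<open>a\<close>.
\<close>

section \<open>Integrals of powers against a moving Gaussian bump\<close>

lemma integrable_Gamma_integrand:
  fixes \<alpha> :: real
  assumes "\<alpha> > 0"
  shows "integrable lborel (\<lambda>x. indicator {0<..} x * (x powr (\<alpha> - 1) * exp (- x)))"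
proof (rule integrableI_nonneg)
  let ?g = "\<lambda>x::real. indicator {0<..} x * (x powr (\<alpha> - 1) * exp (- x))"
  show "?g \<in> borel_measurable lborel" by measurable
  have eq: "?g = (\<lambda>x. if x \<in> {0..} then x powr (\<alpha> - 1) / exp x else 0)"
    by (auto simp: fun_eq_iff indicator_def exp_minus field_simps)
  have "(?g has_integral Gamma \<alpha>) UNIV"
    unfolding eq has_integral_restrict_UNIV using Gamma_integral_real[OF assms] .
  then have "integral\<^sup>N lborel ?g = ennreal (Gamma \<alpha>)"
    by (intro nn_integral_has_integral_lborel) auto
  then show "integral\<^sup>N lborel ?g < \<infinity>" by simp
qed auto

lemma integrable_exp_minus_abs: "integrable lborel (\<lambda>x::real. exp (- \<bar>x\<bar>))"
proof -
  define E where "E = (\<lambda>x::real. indicator {0<..} x * exp (- x) :: real)"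
  have "E = (\<lambda>x. indicator {0<..} x * (x powr (1 - 1) * exp (- x)))"
    by (auto simp: E_def fun_eq_iff indicator_def)
  with integrable_Gamma_integrand[of 1] have E: "integrable lborel E" by simp
  \<comment> \<open>Shifting by 1 makes the two reflected half-lines overlap, so the bound also holds at 0.\<close>
  have "integrable lborel (\<lambda>x. exp 1 * (E (1 + 1 * x) + E (1 + (- 1) * x)))"
    by (intro integrable_mult_right Bochner_Integration.integrable_add
        lborel_integrable_real_affine E) auto
  then show ?thesis
  proof (rule Bochner_Integration.integrable_bound)
    show "AE x in lborel. norm (exp (- \<bar>x\<bar>)) \<le> norm (exp 1 * (E (1 + 1 * x) + E (1 + - 1 * x)))"
    proof (rule AE_I2)
      fix x :: real
      have "exp 1 * E (1 + \<bar>x\<bar>) = exp (- \<bar>x\<bar>)"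
        by (auto simp: E_def indicator_def simp flip: exp_add)
      moreover have "E (1 + \<bar>x\<bar>) \<le> E (1 + 1 * x) + E (1 + - 1 * x)"
        by (auto simp: E_def abs_if)
      moreover have "E (1 + \<bar>x\<bar>) \<ge> 0" by (simp add: E_def)
      ultimately have "exp (- \<bar>x\<bar>) \<le> exp 1 * (E (1 + 1 * x) + E (1 + - 1 * x))"
        by (metis exp_ge_zero mult_left_mono)
      then show "norm (exp (- \<bar>x\<bar>)) \<le> norm (exp 1 * (E (1 + 1 * x) + E (1 + - 1 * x)))"
        by simp
    qed
  qed auto
qed

lemma powr_mult_gaussian_le_exp:
  fixes k \<beta> u :: real
  assumes "\<beta> > 0" "k \<ge> 0" "u \<ge> 0"
  shows "(1 + u) powr k * exp (- (\<beta> / 2 * u\<^sup>2)) \<le> exp ((k + 1)\<^sup>2 / (2 * \<beta>)) * exp (- u)"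
proof -
  have "ln (1 + u) \<le> u" using assms by (intro ln_add_one_self_le_self) auto
  then have "k * ln (1 + u) \<le> k * u" using assms by (intro mult_left_mono) auto
  moreover have "(k + 1) * u - \<beta> / 2 * u\<^sup>2 \<le> (k + 1)\<^sup>2 / (2 * \<beta>)"
  proof -
    have "0 \<le> (\<beta> * u - (k + 1))\<^sup>2 / (2 * \<beta>)" using assms by auto
    also have "\<dots> = (k + 1)\<^sup>2 / (2 * \<beta>) - ((k + 1) * u - \<beta> / 2 * u\<^sup>2)"
      using assms by (simp add: field_simps power2_eq_square)
    finally show ?thesis by simp
  qed
  ultimately have "k * ln (1 + u) - \<beta> / 2 * u\<^sup>2 \<le> (k + 1)\<^sup>2 / (2 * \<beta>) - u"
    by (simp add: algebra_simps)
  then have "exp (k * ln (1 + u) + - (\<beta> / 2 * u\<^sup>2)) \<le> exp ((k + 1)\<^sup>2 / (2 * \<beta>) + - u)"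
    unfolding exp_le_cancel_iff by linarith
  then show ?thesis using assms unfolding exp_add by (simp add: powr_def)
qed

text \<open>Since \<open>x \<le> a (1 + \<bar>x - a\<bar>)\<close> for \<open>a \<ge> 1\<close>, and symmetrically \<open>a \<le> x (1 + \<bar>x - a\<bar>)\<close> for \<open>x \<ge> 1\<close>,
  the first factor on the right suffices except for \<open>x < 1\<close> and \<open>p < 0\<close>. The second factor
  absorbs the singularity \<open>x powr p\<close> at 0; the exponential in it only makes it integrable on all of
  \<open>(0, \<infinity>)\<close>, so that no case distinction is left in the bound.\<close>

lemma powr_ratio_le:
  fixes a x p :: real
  assumes "a \<ge> 1" "x > 0"
  shows "(x / a) powr p \<le> (1 + \<bar>x - a\<bar>) powr \<bar>p\<bar> * (1 + exp 1 * (x powr p * exp (- x)))"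
proof (cases "x \<ge> 1 \<or> p \<ge> 0")
  case True
  let ?u = "1 + \<bar>x - a\<bar>"
  have "(x / a) powr p \<le> ?u powr \<bar>p\<bar>"
  proof (cases "p \<ge> 0")
    case True
    have "x \<le> ?u * a"
    proof -
      have "\<bar>x - a\<bar> * 1 \<le> \<bar>x - a\<bar> * a" using assms by (intro mult_left_mono) auto
      then show ?thesis by (simp add: algebra_simps)
    qed
    then have "x / a \<le> ?u" using assms by (simp add: field_simps)
    then show ?thesis using True assms by (auto intro!: powr_mono2)
  next
    case False
    with \<open>x \<ge> 1 \<or> p \<ge> 0\<close> have x: "x \<ge> 1" by auto
    have "\<bar>x - a\<bar> * 1 \<le> \<bar>x - a\<bar> * x" using x by (intro mult_left_mono) auto
    then have "a \<le> ?u * x" by (simp add: algebra_simps)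
    then have "a / x \<le> ?u" using assms by (simp add: field_simps)
    moreover have "(x / a) powr p = (a / x) powr \<bar>p\<bar>"
      using False assms by (simp add: powr_divide powr_minus field_simps)
    ultimately show ?thesis using assms by (auto intro!: powr_mono2)
  qed
  also have "\<dots> \<le> ?u powr \<bar>p\<bar> * (1 + exp 1 * (x powr p * exp (- x)))"
    by (simp add: algebra_simps)
  finally show ?thesis .
next
  case False
  let ?u = "1 + \<bar>x - a\<bar>"
  have "(x / a) powr p = a powr \<bar>p\<bar> * x powr p"
    using False assms by (simp add: powr_divide powr_minus field_simps)
  also have "\<dots> \<le> ?u powr \<bar>p\<bar> * (1 + exp 1 * (x powr p * exp (- x)))"
  proof (rule mult_mono)
    show "a powr \<bar>p\<bar> \<le> ?u powr \<bar>p\<bar>" using False assms by (intro powr_mono2) auto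
    have "x powr p * 1 \<le> x powr p * exp (1 - x)"
      using False by (intro mult_left_mono) auto
    also have "\<dots> = exp 1 * (x powr p * exp (- x))"
      by (simp add: exp_diff exp_minus field_simps)
    finally show "x powr p \<le> 1 + exp 1 * (x powr p * exp (- x))" by simp
  qed auto
  finally show ?thesis .
qed

text \<open>Up to constant factors this is the product of the Gamma density and \<open>exp (x - \<beta> / 2 * (x - a)\<^sup>2)\<close>,
  extended by 0 to the whole line.\<close>

abbreviation gaussian_weight :: "real \<Rightarrow> real \<Rightarrow> real \<Rightarrow> real \<Rightarrow> real" where
  "gaussian_weight \<alpha> \<beta> a \<equiv>
     (\<lambda>x. indicator {0<..} x * (x powr (\<alpha> - 1) * exp (- (\<beta> / 2 * (x - a)\<^sup>2))))"

text \<open>The point is that \<open>M\<close> does not depend on \<open>a\<close>: after division by \<open>a powr (\<alpha> - 1)\<close> the weight is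
  dominated by a translate of a multiple of \<open>exp (- \<bar>x\<bar>)\<close> plus a multiple of the Gamma integrand.\<close>

lemma gaussian_weight_bound:
  fixes \<alpha> \<beta> :: real
  assumes "\<alpha> > 0" "\<beta> > 0"
  obtains M where "M > 0"
    "\<And>a. a \<ge> 1 \<Longrightarrow> integrable lborel (gaussian_weight \<alpha> \<beta> a)"
    "\<And>a. a \<ge> 1 \<Longrightarrow> integral\<^sup>L lborel (gaussian_weight \<alpha> \<beta> a) \<le> M * a powr (\<alpha> - 1)"
proof -
  define k C where "k = \<bar>\<alpha> - 1\<bar>" and "C = exp ((k + 1)\<^sup>2 / (2 * \<beta>))"
  define w where "w = gaussian_weight \<alpha> \<beta>"
  define g where "g = (\<lambda>x::real. indicator {0<..} x * (x powr (\<alpha> - 1) * exp (- x)) :: real)"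
  define h where "h = (\<lambda>a x. C * (exp (- \<bar>x - a\<bar>) + exp 1 * g x))"
  define J where "J = (LINT x|lborel. exp (- \<bar>x::real\<bar>))"
  define M where "M = C * (J + exp 1 * integral\<^sup>L lborel g) + 1"
  have C: "C > 0" by (simp add: C_def)
  have g: "integrable lborel g" unfolding g_def by (rule integrable_Gamma_integrand[OF assms(1)])
  have g0: "g x \<ge> 0" for x by (simp add: g_def)
  have shift: "integrable lborel (\<lambda>x. exp (- \<bar>x - a\<bar>))" "(LINT x|lborel. exp (- \<bar>x - a\<bar>)) = J" for a :: real
    using lborel_integrable_real_affine[OF integrable_exp_minus_abs, of 1 "- a"]
      lborel_integral_real_affine[of 1 "\<lambda>x. exp (- \<bar>x::real\<bar>)" "- a"]
    by (simp_all add: J_def)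
  have h: "integrable lborel (h a)" for a
    unfolding h_def by (intro integrable_mult_right Bochner_Integration.integrable_add shift g)
  have hI: "integral\<^sup>L lborel (h a) = M - 1" for a
    unfolding h_def M_def using shift[of a] g by simp
  have le: "w a x \<le> a powr (\<alpha> - 1) * h a x" if "a \<ge> 1" for a x
  proof (cases "x > 0")
    case False
    then show ?thesis using C g0[of x] by (auto simp: w_def h_def)
  next
    case True
    let ?u = "\<bar>x - a\<bar>"
    have "w a x = a powr (\<alpha> - 1) * ((x / a) powr (\<alpha> - 1) * exp (- (\<beta> / 2 * ?u\<^sup>2)))"
      using True that by (simp add: w_def powr_divide)
    also have "\<dots> \<le> a powr (\<alpha> - 1) * (((1 + ?u) powr k * (1 + exp 1 * g x)) * exp (- (\<beta> / 2 * ?u\<^sup>2)))"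
      using powr_ratio_le[OF that True, of "\<alpha> - 1"] True
      by (intro mult_left_mono mult_right_mono) (auto simp: k_def g_def)
    also have "\<dots> = a powr (\<alpha> - 1) * (((1 + ?u) powr k * exp (- (\<beta> / 2 * ?u\<^sup>2))) * (1 + exp 1 * g x))"
      by (simp add: mult_ac)
    also have "\<dots> \<le> a powr (\<alpha> - 1) * ((C * exp (- ?u)) * (1 + exp 1 * g x))"
      unfolding C_def using assms g0[of x]
      by (intro mult_left_mono mult_right_mono powr_mult_gaussian_le_exp) (auto simp: k_def)
    also have "\<dots> \<le> a powr (\<alpha> - 1) * h a x"
    proof -
      have "exp (- ?u) * (exp 1 * g x) \<le> 1 * (exp 1 * g x)"
        using g0[of x] by (intro mult_right_mono) auto
      then have "exp (- ?u) * (1 + exp 1 * g x) \<le> exp (- ?u) + exp 1 * g x"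
        by (simp add: algebra_simps)
      then show ?thesis unfolding h_def mult.assoc[of C] using C by (intro mult_left_mono) auto
    qed
    finally show ?thesis .
  qed
  have w0: "w a x \<ge> 0" for a x by (simp add: w_def)
  have int: "integrable lborel (\<lambda>x. a powr (\<alpha> - 1) * h a x)" for a
    using h by (intro integrable_mult_right)
  have wi: "integrable lborel (w a)" if "a \<ge> 1" for a
    using int[of a]
  proof (rule Bochner_Integration.integrable_bound)
    show "w a \<in> borel_measurable lborel" unfolding w_def by measurable
    show "AE x in lborel. norm (w a x) \<le> norm (a powr (\<alpha> - 1) * h a x)"
      using order_trans[OF le[OF that] abs_ge_self] w0 by (intro AE_I2) simp
  qed
  show thesis
  proof (rule that[of M])
    have "J \<ge> 0" "integral\<^sup>L lborel g \<ge> 0" using g0 by (auto simp: J_def)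
    then show "M > 0" using C by (auto simp: M_def intro!: add_nonneg_pos)
  next
    fix a :: real assume a: "a \<ge> 1"
    show "integrable lborel (gaussian_weight \<alpha> \<beta> a)"
      using wi[OF a] by (simp add: w_def)
    have "integral\<^sup>L lborel (w a) \<le> (LINT x|lborel. a powr (\<alpha> - 1) * h a x)"
      by (intro integral_mono wi a int le)
    also have "\<dots> = a powr (\<alpha> - 1) * (M - 1)" by (simp add: hI)
    also have "\<dots> \<le> M * a powr (\<alpha> - 1)" by (simp add: algebra_simps)
    finally show "integral\<^sup>L lborel (gaussian_weight \<alpha> \<beta> a) \<le> M * a powr (\<alpha> - 1)"
      by (simp add: w_def)
  qed
qed

section \<open>The Gamma measure\<close>

lemma
  assumes "\<alpha> > 0" "f \<in> borel_measurable borel"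
  shows integrable_gamma_measure_iff: "integrable (gamma_measure \<alpha>) f \<longleftrightarrow>
      integrable lborel (\<lambda>x. indicator {0<..} x * (gamma_density \<alpha> x * f x :: real))" (is ?A)
    and integral_gamma_measure: "integral\<^sup>L (gamma_measure \<alpha>) f =
      (LINT x|lborel. indicator {0<..} x * (gamma_density \<alpha> x * f x))" (is ?B)
proof -
  let ?R = "restrict_space lborel {0::real<..}"
  have d: "gamma_density \<alpha> \<in> borel_measurable ?R"
    unfolding gamma_density_def by (intro measurable_restrict_space1) measurable
  have f: "f \<in> borel_measurable ?R"
    using assms(2) by (intro measurable_restrict_space1) auto
  have nn: "AE x in ?R. 0 \<le> gamma_density \<alpha> x"
    using Gamma_real_pos[OF assms(1)] by (auto simp: gamma_density_def)
  show ?A unfolding gamma_measure_def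
    by (subst integrable_density[OF f d nn], subst integrable_restrict_space) auto
  show ?B unfolding gamma_measure_def
    by (subst integral_density[OF f d nn], subst integral_restrict_space) auto
qed

lemma space_gamma_measure [simp]: "space (gamma_measure \<alpha>) = {0<..}"
  by (simp add: gamma_measure_def space_restrict_space)

lemma sets_gamma_measure: "sets (gamma_measure \<alpha>) = sets (restrict_space borel {0<..})"
  by (simp add: gamma_measure_def sets_restrict_space)

text \<open>As \<open>d \<le> a\<close>, the ratio \<open>x / a\<close> lies in \<open>[1, 2]\<close> on the interval, which bounds
  \<open>(x / a) powr (\<alpha> - 1)\<close> below for either sign of \<open>\<alpha> - 1\<close>.\<close>

lemma emeasure_gamma_measure_Icc_ge:
  fixes \<alpha> d a :: real
  assumes "\<alpha> > 0" "d > 0" "a \<ge> d"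
  shows "emeasure (gamma_measure \<alpha>) {a..a + d} \<ge>
    ennreal (d * 2 powr (- \<bar>\<alpha> - 1\<bar>) * exp (- d) / Gamma \<alpha> * (a powr (\<alpha> - 1) * exp (- a)))"
proof -
  let ?R = "restrict_space lborel {0::real<..}"
  define c where "c = 2 powr (- \<bar>\<alpha> - 1\<bar>) * exp (- d) / Gamma \<alpha> * (a powr (\<alpha> - 1) * exp (- a))"
  have G: "Gamma \<alpha> > 0" using Gamma_real_pos[OF assms(1)] .
  have c0: "c \<ge> 0" using G by (simp add: c_def)
  have le: "c \<le> gamma_density \<alpha> x" if x: "x \<in> {a..a + d}" for x
  proof -
    have "2 powr (- \<bar>\<alpha> - 1\<bar>) \<le> (x / a) powr (\<alpha> - 1)"
    proof (cases "\<alpha> \<ge> 1")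
      case True
      have "2 powr (- \<bar>\<alpha> - 1\<bar>) \<le> 2 powr 0" by (intro powr_mono) auto
      also have "\<dots> = 1 powr (\<alpha> - 1)" by simp
      also have "\<dots> \<le> (x / a) powr (\<alpha> - 1)"
        using True x assms by (intro powr_mono2) auto
      finally show ?thesis .
    next
      case False
      then have "2 powr (\<alpha> - 1) \<le> (x / a) powr (\<alpha> - 1)"
        using x assms by (intro powr_mono2') (auto simp: field_simps)
      then show ?thesis using False by simp
    qed
    moreover have "exp (- d) * exp (- a) \<le> exp (- x)"
      using x by (auto simp flip: exp_add)
    ultimately have "2 powr (- \<bar>\<alpha> - 1\<bar>) * (exp (- d) * exp (- a)) \<le> (x / a) powr (\<alpha> - 1) * exp (- x)"
      by (intro mult_mono) auto
    then have "a powr (\<alpha> - 1) / Gamma \<alpha> * (2 powr (- \<bar>\<alpha> - 1\<bar>) * (exp (- d) * exp (- a)))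
        \<le> a powr (\<alpha> - 1) / Gamma \<alpha> * ((x / a) powr (\<alpha> - 1) * exp (- x))"
      using G by (intro mult_left_mono) auto
    moreover have "a powr (\<alpha> - 1) / Gamma \<alpha> * ((x / a) powr (\<alpha> - 1) * exp (- x)) = gamma_density \<alpha> x"
      using x assms by (simp add: gamma_density_def powr_divide)
    ultimately show ?thesis by (simp add: c_def mult_ac)
  qed
  have sets: "{a..a + d} \<in> sets ?R" using assms by (auto simp: sets_restrict_space_iff)
  have meas: "(\<lambda>x. ennreal (gamma_density \<alpha> x)) \<in> borel_measurable ?R"
    unfolding gamma_density_def by (intro measurable_restrict_space1) measurable
  have "emeasure ?R {a..a + d} = ennreal d"
    using assms by (subst emeasure_restrict_space) auto
  then have "ennreal (d * c) = (\<integral>\<^sup>+x. ennreal c * indicator {a..a + d} x \<partial>?R)"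
    using assms c0 sets
    by (simp add: nn_integral_cmult_indicator ennreal_mult mult.commute)
  also have "\<dots> \<le> (\<integral>\<^sup>+x. ennreal (gamma_density \<alpha> x) * indicator {a..a + d} x \<partial>?R)"
    using le by (intro nn_integral_mono) (auto simp: indicator_def intro!: ennreal_leI)
  also have "\<dots> = emeasure (gamma_measure \<alpha>) {a..a + d}"
    unfolding gamma_measure_def by (rule emeasure_density[OF meas sets, symmetric])
  finally show ?thesis by (simp add: c_def mult_ac)
qed

section \<open>Densities with quadratic logarithm\<close>

lemma normalised_gaussian_in_semi_log_convex_densities:
  fixes \<alpha> \<beta> a :: real
  defines "Z \<equiv> integral\<^sup>L lborel (gaussian_weight \<alpha> \<beta> a) / Gamma \<alpha>"
  assumes "\<alpha> > 0"
    and int: "integrable lborel (gaussian_weight \<alpha> \<beta> a)"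
  shows "Z > 0"
    and "(\<lambda>x. exp (x - \<beta> / 2 * (x - a)\<^sup>2) / Z) \<in> semi_log_convex_densities \<beta> \<alpha>"
proof -
  let ?w = "gaussian_weight \<alpha> \<beta> a"
  define f where "f = (\<lambda>x. exp (x - \<beta> / 2 * (x - a)\<^sup>2) / Z)"
  have G: "Gamma \<alpha> > 0" using Gamma_real_pos[OF assms(2)] .
  have "integral\<^sup>L lborel ?w > 0"
  proof (rule ccontr)
    assume "\<not> ?thesis"
    moreover have "integral\<^sup>L lborel ?w \<ge> 0" by (intro integral_nonneg_AE) auto
    ultimately have "integral\<^sup>L lborel ?w = 0" by linarith
    moreover have "AE x in lborel. 0 \<le> ?w x" by (intro AE_I2) simp
    ultimately have "AE x in lborel. ?w x = 0"
      using integral_nonneg_eq_0_iff_AE[OF int] by blast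
    \<comment> \<open>The weight is positive on \<open>(0, \<infinity>)\<close>; any subinterval of positive length gives the contradiction.\<close>
    then have "AE x in lborel. x \<notin> {1..2::real}"
      by eventually_elim (auto simp: indicator_def split: if_splits)
    then have "emeasure lborel {1..2::real} = 0"
      by (subst (asm) AE_iff_measurable[of "{1..2}"]) auto
    then show False by simp
  qed
  then have w: "integral\<^sup>L lborel ?w = Gamma \<alpha> * Z" and Z: "Z > 0" using G by (simp_all add: Z_def)
  show "Z > 0" by (rule Z)
  have df: "(f has_real_derivative (1 - \<beta> * (x - a)) * f x) (at x)" for x
    unfolding f_def using Z by (auto intro!: derivative_eq_intros simp: field_simps)
  have dd: "deriv f = (\<lambda>x. (1 - \<beta> * (x - a)) * f x)"
    using df by (auto intro: DERIV_imp_deriv)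
  have lnf: "(\<lambda>y. ln (f y)) = (\<lambda>y. y - \<beta> / 2 * (y - a)\<^sup>2 - ln Z)"
    using Z by (simp add: f_def fun_eq_iff ln_div)
  have d1: "deriv (\<lambda>y. ln (f y)) = (\<lambda>y. 1 - \<beta> * (y - a))"
    unfolding lnf by (rule ext, rule DERIV_imp_deriv) (auto intro!: derivative_eq_intros simp: field_simps)
  have d2: "deriv (\<lambda>y. 1 - \<beta> * (y - a)) x = - \<beta>" for x
    by (rule DERIV_imp_deriv) (auto intro!: derivative_eq_intros)
  have fd: "f differentiable at x" for x using df real_differentiable_def by blast
  have meas: "f \<in> borel_measurable borel" unfolding f_def by measurable
  have eq: "(\<lambda>x. indicator {0<..} x * (gamma_density \<alpha> x * f x)) = (\<lambda>x. ?w x * (1 / (Gamma \<alpha> * Z)))"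
  proof
    fix x
    have "exp (- x) * exp (x - \<beta> / 2 * (x - a)\<^sup>2) = exp (- (\<beta> / 2 * (x - a)\<^sup>2))"
      by (simp flip: exp_add)
    then show "indicator {0<..} x * (gamma_density \<alpha> x * f x) = ?w x * (1 / (Gamma \<alpha> * Z))"
      by (simp add: f_def gamma_density_def mult.assoc)
  qed
  have "integrable (gamma_measure \<alpha>) f"
    unfolding integrable_gamma_measure_iff[OF assms(2) meas] eq using int by (rule integrable_mult_left)
  moreover have "integral\<^sup>L (gamma_measure \<alpha>) f = 1"
    unfolding integral_gamma_measure[OF assms(2) meas] eq integral_mult_left_zero w
    using G Z by simp
  moreover have "deriv f differentiable at x" for x
    unfolding dd using fd by (intro differentiable_mult derivative_intros) auto
  moreover have "f x > 0" for x using Z by (simp add: f_def)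
  ultimately have "f \<in> semi_log_convex_densities \<beta> \<alpha>"
    using fd by (simp add: semi_log_convex_densities_def d1 d2)
  then show "(\<lambda>x. exp (x - \<beta> / 2 * (x - a)\<^sup>2) / Z) \<in> semi_log_convex_densities \<beta> \<alpha>"
    by (simp add: f_def)
qed

theorem proposition4p1:
  fixes \<alpha> \<beta> :: real
  assumes "\<alpha> > 0" and "\<beta> > 0"
  shows "Limsup at_top
           (\<lambda>t::real. ennreal t *
              (SUP f \<in> semi_log_convex_densities \<beta> \<alpha>.
                 emeasure (gamma_measure \<alpha>) {x \<in> space (gamma_measure \<alpha>). f x \<ge> t})) > 0"
  (is "Limsup at_top ?F > 0")
proof -
  obtain M where M: "M > 0" and
    int: "\<And>a. a \<ge> 1 \<Longrightarrow> integrable lborel (gaussian_weight \<alpha> \<beta> a)" and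
    bound: "\<And>a. a \<ge> 1 \<Longrightarrow> integral\<^sup>L lborel (gaussian_weight \<alpha> \<beta> a) \<le> M * a powr (\<alpha> - 1)"
    by (rule gaussian_weight_bound[OF assms]) (rule that)
  \<comment> \<open>\<open>\<beta> / 2 * u\<^sup>2 \<le> u\<close> exactly for \<open>u\<close> between 0 and \<open>d\<close>.\<close>
  define d where "d = 2 / \<beta>"
  define c where "c = d * 2 powr (- \<bar>\<alpha> - 1\<bar>) * exp (- d) / Gamma \<alpha>"
  define Z where "Z = (\<lambda>a. integral\<^sup>L lborel (gaussian_weight \<alpha> \<beta> a) / Gamma \<alpha>)"
  have G: "Gamma \<alpha> > 0" using Gamma_real_pos[OF assms(1)] .
  have d: "d > 0" using assms by (simp add: d_def)
  have c: "c > 0" using d G by (simp add: c_def)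
  define K where "K = M / Gamma \<alpha>"
  have K: "K > 0" using M G by (simp add: K_def)
  have Zle: "Z a \<le> K * a powr (\<alpha> - 1)" if "a \<ge> 1" for a
    using bound[OF that] G by (simp add: Z_def K_def field_simps)
  have Zpos: "Z a > 0" if "a \<ge> 1" for a
    unfolding Z_def using normalised_gaussian_in_semi_log_convex_densities(1)[OF assms(1) int[OF that]] .
  have F: "?F (exp a / Z a) \<ge> ennreal (c / K)" if a: "a \<ge> 1" "a \<ge> d" for a
  proof -
    define f where "f = (\<lambda>x. exp (x - \<beta> / 2 * (x - a)\<^sup>2) / Z a)"
    define t where "t = exp a / Z a"
    define S where "S = {x \<in> space (gamma_measure \<alpha>). f x \<ge> t}"
    have fF: "f \<in> semi_log_convex_densities \<beta> \<alpha>"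
      unfolding f_def Z_def using normalised_gaussian_in_semi_log_convex_densities(2)[OF assms(1) int[OF a(1)]] .
    have t: "t > 0" using Zpos[OF a(1)] by (simp add: t_def)
    have sub: "{a..a + d} \<subseteq> S"
    proof
      fix x assume x: "x \<in> {a..a + d}"
      have "(x - a) * (\<beta> / 2 * (x - a)) \<le> (x - a) * 1"
        using x assms by (intro mult_left_mono) (auto simp: d_def field_simps)
      then have "a \<le> x - \<beta> / 2 * (x - a)\<^sup>2" by (simp add: power2_eq_square mult_ac)
      then show "x \<in> S"
        using x a Zpos[OF a(1)] by (auto simp: S_def f_def t_def divide_right_mono)
    qed
    have "f \<in> borel_measurable borel" unfolding f_def by measurable
    then have "{0<..} \<inter> {x. f x \<ge> t} \<in> sets borel" by measurable
    then have S: "S \<in> sets (gamma_measure \<alpha>)"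
      by (auto simp: S_def sets_gamma_measure sets_restrict_space_iff Int_def)
    have "c / K \<le> t * (c * (a powr (\<alpha> - 1) * exp (- a)))"
    proof -
      have "c / K = c * a powr (\<alpha> - 1) / (K * a powr (\<alpha> - 1))" using a by simp
      also have "\<dots> \<le> c * a powr (\<alpha> - 1) / Z a"
        using Zle[OF a(1)] Zpos[OF a(1)] c by (intro divide_left_mono) auto
      also have "\<dots> = t * (c * (a powr (\<alpha> - 1) * exp (- a)))"
        by (simp add: t_def exp_minus)
      finally show ?thesis .
    qed
    then have "ennreal (c / K) \<le> ennreal t * ennreal (c * (a powr (\<alpha> - 1) * exp (- a)))"
      using t c by (subst ennreal_mult[symmetric]) (auto intro: ennreal_leI)
    also have "\<dots> \<le> ennreal t * emeasure (gamma_measure \<alpha>) {a..a + d}"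
      unfolding c_def by (intro mult_left_mono emeasure_gamma_measure_Icc_ge assms d a) auto
    also have "\<dots> \<le> ennreal t * emeasure (gamma_measure \<alpha>) S"
      by (intro mult_left_mono emeasure_mono sub S) auto
    also have "\<dots> \<le> ?F t"
      unfolding S_def by (intro mult_left_mono SUP_upper fF) auto
    finally show ?thesis by (simp add: t_def)
  qed
  have "filterlim (\<lambda>a. exp a / (K * a powr (\<alpha> - 1))) at_top at_top"
    using K by real_asymp
  then have lim: "filterlim (\<lambda>a. exp a / Z a) at_top at_top"
  proof (rule filterlim_at_top_mono)
    show "\<forall>\<^sub>F a in at_top. exp a / (K * a powr (\<alpha> - 1)) \<le> exp a / Z a"
      using eventually_ge_at_top[of 1]
      by eventually_elim (use Zle Zpos K in \<open>auto intro!: divide_left_mono\<close>)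
  qed
  have "ennreal (c / K) \<le> Limsup at_top ?F"
    unfolding Limsup_def
  proof (safe intro!: INF_greatest)
    fix P :: "real \<Rightarrow> bool" assume "eventually P at_top"
    then have "eventually (\<lambda>a. P (exp a / Z a)) at_top"
      using lim by (rule eventually_compose_filterlim)
    then have "eventually (\<lambda>a. P (exp a / Z a) \<and> a \<ge> 1 \<and> a \<ge> d) at_top"
      by (intro eventually_conj eventually_ge_at_top)
    then obtain a where a: "P (exp a / Z a)" "a \<ge> 1" "a \<ge> d"
      using eventually_happens'[OF trivial_limit_at_top_linorder] by blast
    show "ennreal (c / K) \<le> Sup (?F ` Collect P)"
      using F[OF a(2,3)] a(1) by (intro SUP_upper2[of "exp a / Z a"]) auto
  qed
  moreover have "0 < ennreal (c / K)" using c K by simp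
  ultimately show ?thesis by (rule less_le_trans[rotated])
qed

end
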